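(* Let $G$ be a connected simple graph with $n=|V(G)|$ vertices and minimum degree $\delta=\delta(G)$, let $k\in(0,n)$ be a real number, and let $s\ge 1$ be an integer. Each of the following holds. (i) If $G$ has a subgraph $L$ with $\Delta(L)\le 2$ and $|E(L)|\ge 2s$, then $\mu_f(G)\ge s$. In particular, if $G$ has a cycle or path with at least $2\delta$ edges, then $\mu_f(G)\ge\delta$. (ii) If $\delta>\frac{n-k}{2}$, then $\mu_f(G)>\frac{n-k}{2}$.
   Context: Graphs are finite, simple and undirected; $\Delta(L)$ is the maximum degree of $L$. A fractional matching of $G$ is a function $f:E(G)\to[0,1]$ such that for every vertex $v$ the sum of $f(e)$ over all edges $e$ incident with $v$ is at most $1$. The fractional matching number is $\mu_f(G)=\max\{\sum_{e\in E(G)}f(e): f \text{ is a fractional matching of } G\}$. *)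

theory Defs
  imports "HOL-Analysis.Analysis"
begin

record 'a graph =
  verts :: "'a set"
  edges :: "'a set set"

definition simple_graph :: "'a graph \<Rightarrow> bool" where
  "simple_graph G \<longleftrightarrow> finite (verts G) \<and> (\<forall>e\<in>edges G. e \<subseteq> verts G \<and> card e = 2)"

definition subgraph :: "'a graph \<Rightarrow> 'a graph \<Rightarrow> bool" where
  "subgraph L G \<longleftrightarrow> simple_graph L \<and> verts L \<subseteq> verts G \<and> edges L \<subseteq> edges G"

definition adjacent :: "'a graph \<Rightarrow> 'a \<Rightarrow> 'a \<Rightarrow> bool" where
  "adjacent G u v \<longleftrightarrow> {u, v} \<in> edges G"

definition vertex_degree :: "'a graph \<Rightarrow> 'a \<Rightarrow> nat" where
  "vertex_degree G v = card {e \<in> edges G. v \<in> e}"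

(* For a graph without vertices, min_degree and max_degree are unspecified. *)
definition min_degree :: "'a graph \<Rightarrow> nat" where
  "min_degree G = Min (vertex_degree G ` verts G)"

definition max_degree :: "'a graph \<Rightarrow> nat" where
  "max_degree G = Max (vertex_degree G ` verts G)"

(* A path is given by its sequence of vertices; it has length p - 1 edges.
   The one-vertex path, with no edges, is allowed. *)
definition is_path :: "'a graph \<Rightarrow> 'a list \<Rightarrow> bool" where
  "is_path G p \<longleftrightarrow>
     p \<noteq> [] \<and> set p \<subseteq> verts G \<and> distinct p \<and> successively (adjacent G) p"

(* A cycle is given by its sequence of distinct vertices, the first one not being
   repeated at the end; it has length c edges, including the closing one. *)
definition is_cycle :: "'a graph \<Rightarrow> 'a list \<Rightarrow> bool" where
  "is_cycle G c \<longleftrightarrow> is_path G c \<and> length c \<ge> 3 \<and> adjacent G (last c) (hd c)"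

definition connected_graph :: "'a graph \<Rightarrow> bool" where
  "connected_graph G \<longleftrightarrow> verts G \<noteq> {} \<and>
     (\<forall>u\<in>verts G. \<forall>v\<in>verts G. \<exists>p. is_path G p \<and> hd p = u \<and> last p = v)"

(* Values of f outside the edge set are irrelevant. *)
definition fractional_matching :: "'a graph \<Rightarrow> ('a set \<Rightarrow> real) \<Rightarrow> bool" where
  "fractional_matching G f \<longleftrightarrow>
     (\<forall>e\<in>edges G. 0 \<le> f e \<and> f e \<le> 1) \<and>
     (\<forall>v\<in>verts G. (\<Sum>e | e \<in> edges G \<and> v \<in> e. f e) \<le> 1)"

(* Max is only meaningful on finite sets, hence GREATEST; the maximum is attained by
   fractional_matching_number_attained below. *)
definition fractional_matching_number :: "'a graph \<Rightarrow> real" where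
  "fractional_matching_number G =
     (GREATEST x. \<exists>f. fractional_matching G f \<and> x = (\<Sum>e\<in>edges G. f e))"

lemma fractional_matching_max_exists:
  fixes G :: "'a graph"
  shows "\<exists>f. fractional_matching G f \<and>
    (\<forall>g. fractional_matching G g \<longrightarrow> (\<Sum>e\<in>edges G. g e) \<le> (\<Sum>e\<in>edges G. f e))"
proof -
  define B :: "('a set \<Rightarrow> real) set"
    where "B = PiE UNIV (\<lambda>e. if e \<in> edges G then {0..1} else {0})"
  define C :: "('a set \<Rightarrow> real) set"
    where "C = {f. \<forall>v\<in>verts G. (\<Sum>e | e \<in> edges G \<and> v \<in> e. f e) \<le> 1}"
  have comp: "compact B"
  proof -
    have "compactin (product_topology (\<lambda>_. euclidean) UNIV) B"
      unfolding B_def by (subst compactin_PiE) auto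
    then show ?thesis
      by (simp add: euclidean_product_topology)
  qed
  have cont: "continuous_on UNIV (\<lambda>f :: 'a set \<Rightarrow> real. \<Sum>e\<in>A. f e)" for A
    by (intro continuous_intros continuous_on_product_coordinates)
  have closed: "closed C"
    unfolding C_def
    by (unfold Ball_def, intro closed_Collect_all closed_Collect_imp closed_Collect_le cont continuous_on_const open_Collect_const)
  have "compact (B \<inter> C)"
    using comp closed by (rule compact_Int_closed)
  moreover have "(\<lambda>_. 0) \<in> B \<inter> C"
    by (auto simp: B_def C_def)
  moreover have "continuous_on (B \<inter> C) (\<lambda>f. \<Sum>e\<in>edges G. f e)"
    using cont by (rule continuous_on_subset) auto
  ultimately obtain f where f: "f \<in> B \<inter> C"
    and max: "\<And>g. g \<in> B \<inter> C \<Longrightarrow> (\<Sum>e\<in>edges G. g e) \<le> (\<Sum>e\<in>edges G. f e)"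
    using continuous_attains_sup[of "B \<inter> C"] by blast
  have "0 \<le> f e \<and> f e \<le> 1" if "e \<in> edges G" for e
    using f that by (auto simp: B_def PiE_iff dest!: spec[of _ e])
  then have "fractional_matching G f"
    using f by (auto simp: fractional_matching_def C_def)
  moreover have "(\<Sum>e\<in>edges G. g e) \<le> (\<Sum>e\<in>edges G. f e)"
    if g: "fractional_matching G g" for g
  proof -
    define h where "h e = (if e \<in> edges G then g e else 0)" for e
    have "(\<Sum>e | e \<in> edges G \<and> v \<in> e. h e) = (\<Sum>e | e \<in> edges G \<and> v \<in> e. g e)" for v
      by (rule sum.cong) (auto simp: h_def)
    then have "h \<in> B \<inter> C"
      using g by (auto simp: B_def C_def fractional_matching_def h_def)
    from max[OF this] show ?thesis
      by (simp add: h_def cong: sum.cong)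
  qed
  ultimately show ?thesis by blast
qed

lemma
  fixes G :: "'a graph"
  shows fractional_matching_number_attained:
      "\<exists>f. fractional_matching G f \<and> fractional_matching_number G = (\<Sum>e\<in>edges G. f e)"
    and fractional_matching_number_upper:
      "fractional_matching G g \<Longrightarrow> (\<Sum>e\<in>edges G. g e) \<le> fractional_matching_number G"
proof -
  obtain f where f: "fractional_matching G f"
    and max: "\<And>g. fractional_matching G g \<Longrightarrow> (\<Sum>e\<in>edges G. g e) \<le> (\<Sum>e\<in>edges G. f e)"
    using fractional_matching_max_exists by blast
  have eq: "fractional_matching_number G = (\<Sum>e\<in>edges G. f e)"
    unfolding fractional_matching_number_def
    by (rule Greatest_equality) (use f max in auto)
  show "\<exists>f. fractional_matching G f \<and> fractional_matching_number G = (\<Sum>e\<in>edges G. f e)"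
    using f eq by blast
  show "fractional_matching G g \<Longrightarrow> (\<Sum>e\<in>edges G. g e) \<le> fractional_matching_number G"
    using max eq by simp
qed

end

(* For (i), put weight 1/2 on every edge of L, of the path or of the cycle.
   For (ii), take a maximum matching M.  If two vertices u, v are unmatched, then no edge {x, y} of M
   has x adjacent to u and y adjacent to v, since u-x-y-v would be augmenting; so at most two
   edges join {u, v} to each edge of M, whence 2 delta <= deg u + deg v <= 2 |M|.
   If exactly one vertex u is unmatched and |M| < delta, then u is adjacent to both ends of some
   edge of M; weight 1/2 on the resulting triangle and 1 on the rest of M has total n/2.
   If M is perfect, its weight is n/2.  In each case the fractional matching number is at least
   delta or at least n/2 > (n - k)/2. *)
theory Submission
  imports Defs
begin

section \<open>Lower bounds from half-integral weights\<close>

lemma simple_graph_finite_edges: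
  assumes "simple_graph G"
  shows "finite (edges G)"
proof (rule finite_subset)
  show "edges G \<subseteq> Pow (verts G)" "finite (Pow (verts G))"
    using assms by (auto simp: simple_graph_def)
qed

text \<open>Weight 1 on \<open>A\<close> and 1/2 on \<open>B\<close> is a fractional matching:
  \<open>deg\<close> is the vertex constraint doubled, so that it can be checked by counting in the
  naturals. Every lower bound below comes from this: \<open>B\<close> alone serves subgraphs, paths
  and cycles, \<open>A\<close> alone serves matchings, and both together serve a matching combined
  with a triangle.\<close>

lemma half_integral_le_fractional_matching_number:
  assumes G: "simple_graph G" and A: "A \<subseteq> edges G" and B: "B \<subseteq> edges G" and disj: "A \<inter> B = {}"
    and deg: "\<And>v. v \<in> verts G \<Longrightarrow> 2 * card {e \<in> A. v \<in> e} + card {e \<in> B. v \<in> e} \<le> 2"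
  shows "real (card A) + real (card B) / 2 \<le> fractional_matching_number G"
proof -
  define f :: "'a set \<Rightarrow> real" where "f e = of_bool (e \<in> A) + of_bool (e \<in> B) / 2" for e
  have fin: "finite (edges G)" by (rule simple_graph_finite_edges[OF G])
  have sum_f: "sum f F = real (card (F \<inter> A)) + real (card (F \<inter> B)) / 2" if "finite F" for F
    using that by (simp add: f_def sum.distrib sum_divide_distrib[symmetric] Int_def)
  have "fractional_matching G f"
    unfolding fractional_matching_def
  proof (intro conjI ballI)
    fix e assume "e \<in> edges G"
    \<comment> \<open>Disjointness keeps an edge from receiving 1 + 1/2.\<close>
    show "0 \<le> f e" "f e \<le> 1" using disj by (auto simp: f_def of_bool_def)
  next
    fix v assume v: "v \<in> verts G"
    have "{e \<in> edges G. v \<in> e} \<inter> A = {e \<in> A. v \<in> e}" "{e \<in> edges G. v \<in> e} \<inter> B = {e \<in> B. v \<in> e}"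
      using A B by auto
    with sum_f[of "{e \<in> edges G. v \<in> e}"] fin
    have "(\<Sum>e | e \<in> edges G \<and> v \<in> e. f e)
        = real (card {e \<in> A. v \<in> e}) + real (card {e \<in> B. v \<in> e}) / 2"
      by simp
    then show "(\<Sum>e | e \<in> edges G \<and> v \<in> e. f e) \<le> 1" using deg[OF v] by linarith
  qed
  from fractional_matching_number_upper[OF this] sum_f[OF fin] A B
  show ?thesis by (simp add: Int_absorb1)
qed

section \<open>Subgraphs of maximum degree two, paths and cycles\<close>

lemma fractional_matching_number_ge_subgraph:
  assumes G: "simple_graph G" and L: "subgraph L G" "max_degree L \<le> 2"
  shows "real (card (edges L)) / 2 \<le> fractional_matching_number G"
proof -
  have "card {e \<in> edges L. v \<in> e} \<le> 2" for v
  proof (cases "v \<in> verts L")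
    case True
    have "finite (verts L)" using L by (simp add: subgraph_def simple_graph_def)
    then have "vertex_degree L v \<le> max_degree L" unfolding max_degree_def using True by simp
    then show ?thesis using L by (simp add: vertex_degree_def)
  next
    \<comment> \<open>\<open>max_degree L\<close> says nothing about a vertex outside
      \<open>L\<close>, but no edge of \<open>L\<close> meets it. This case also covers an
      \<open>L\<close> without vertices, whose \<open>max_degree\<close> is unspecified.\<close>
    case False
    then have "{e \<in> edges L. v \<in> e} = {}" using L by (auto simp: subgraph_def simple_graph_def)
    then show ?thesis by (metis card.empty zero_le)
  qed
  then show ?thesis
    using half_integral_le_fractional_matching_number[OF G, of "{}" "edges L"] L
    by (simp add: subgraph_def)
qed

text \<open>Common core for paths and cycles: an index \<open>i\<close> stands for the edge from
  \<open>p ! i\<close> to its cyclic successor. A cycle uses all indices, a path all but the last.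
  Each vertex lies on at most two such edges, so weight 1/2 on each is admissible.\<close>

lemma fractional_matching_number_ge_cyclic_indices:
  assumes G: "simple_graph G" and p: "distinct p" "length p \<ge> 3" and I: "I \<subseteq> {..<length p}"
    and edge: "\<And>i. i \<in> I \<Longrightarrow> {p ! i, p ! (Suc i mod length p)} \<in> edges G"
  shows "real (card I) / 2 \<le> fractional_matching_number G"
proof -
  let ?s = "\<lambda>i. Suc i mod length p"
  define E where "E i = {p ! i, p ! ?s i}" for i
  have s: "?s i = (if Suc i = length p then 0 else Suc i)" if "i < length p" for i
    using that by (simp add: mod_Suc)
  have s_lt: "?s i < length p" if "i < length p" for i
    using that by (intro mod_less_divisor) linarith
  have nth_eq: "p ! i = p ! j \<longleftrightarrow> i = j" if "i < length p" "j < length p" for i j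
    using p that by (simp add: nth_eq_iff_index_eq)
  have inj: "inj_on E I"
  proof (rule inj_onI)
    fix i j assume "i \<in> I" "j \<in> I" and eq: "E i = E j"
    then have lt: "i < length p" "j < length p" using I by auto
    \<comment> \<open>Equal doubletons agree either straight or crosswise. Crosswise,
      \<open>i\<close> and \<open>j\<close> would be each other's cyclic successors, which is
      impossible with at least three vertices.\<close>
    from eq have "i = j \<or> i = ?s j \<and> ?s i = j"
      using lt s_lt by (auto simp: E_def doubleton_eq_iff nth_eq)
    then show "i = j" using lt p(2) by (auto simp: s split: if_splits)
  qed
  have finI: "finite I" using I finite_subset by blast
  have "card {e \<in> E ` I. v \<in> e} \<le> 2" for v
  proof -
    \<comment> \<open>Counting indices is enough, since the edges at \<open>v\<close> are the images
      of these indices under \<open>E\<close>.\<close>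
    have "card {i \<in> I. v \<in> E i} \<le> 2"
    proof (cases "v \<in> set p")
      case True
      then obtain j where j: "j < length p" "v = p ! j" by (auto simp: in_set_conv_nth)
      \<comment> \<open>Only the edges leaving and entering position \<open>j\<close> contain
        \<open>v\<close>; the cyclic predecessor of 0 is the last index.\<close>
      have "{i \<in> I. v \<in> E i} \<subseteq> {j, if j = 0 then length p - 1 else j - 1}"
      proof
        fix i assume i: "i \<in> {i \<in> I. v \<in> E i}"
        then have lt: "i < length p" using I by auto
        with i have "j = i \<or> j = ?s i"
          using j s_lt by (auto simp: E_def nth_eq)
        then show "i \<in> {j, if j = 0 then length p - 1 else j - 1}"
          using lt by (auto simp: s split: if_splits)
      qed
      from card_mono[OF _ this] show ?thesis
        by (rule order_trans) (auto simp: card_insert_if)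
    next
      case False
      have "v \<notin> E i" if "i \<in> I" for i
      proof -
        have "i < length p" using that I by auto
        then show ?thesis using False s_lt[of i] by (auto simp: E_def)
      qed
      then have "{i \<in> I. v \<in> E i} = {}" by auto
      then show ?thesis by (metis card.empty zero_le)
    qed
    moreover have "{e \<in> E ` I. v \<in> e} = E ` {i \<in> I. v \<in> E i}" by auto
    ultimately show ?thesis
      using card_image_le[of "{i \<in> I. v \<in> E i}" E] finI by simp
  qed
  moreover have "E ` I \<subseteq> edges G" using edge by (auto simp: E_def)
  ultimately show ?thesis
    using half_integral_le_fractional_matching_number[OF G, of "{}" "E ` I"]
    by (simp add: card_image[OF inj])
qed

lemma path_edge:
  assumes "is_path G p" "Suc i < length p"
  shows "{p ! i, p ! Suc i} \<in> edges G"
  using assms by (auto simp: is_path_def successively_conv_nth adjacent_def)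

text \<open>Leaving out the last index discards the closing pair, which need not be an edge, so no
  remaining index wraps around.\<close>

lemma fractional_matching_number_ge_path:
  assumes G: "simple_graph G" and p: "is_path G p" "length p \<ge> 3"
  shows "real (length p - 1) / 2 \<le> fractional_matching_number G"
  using fractional_matching_number_ge_cyclic_indices[OF G _ p(2), of "{..<length p - 1}"] p path_edge[OF p(1)]
  by (auto simp: is_path_def)

lemma fractional_matching_number_ge_cycle:
  assumes G: "simple_graph G" and c: "is_cycle G c"
  shows "real (length c) / 2 \<le> fractional_matching_number G"
proof -
  have path: "is_path G c" and len: "length c \<ge> 3" and close: "adjacent G (last c) (hd c)"
    using c by (auto simp: is_cycle_def)
  have "{c ! i, c ! (Suc i mod length c)} \<in> edges G" if "i < length c" for i
  proof (cases "Suc i = length c")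
    case True
    moreover have "c \<noteq> []" using len by auto
    ultimately have "c ! i = last c" "c ! 0 = hd c"
      by (simp_all add: last_conv_nth hd_conv_nth flip: True)
    with True close show ?thesis by (simp add: adjacent_def)
  next
    case False
    with that path_edge[OF path, of i] show ?thesis by simp
  qed
  then show ?thesis
    using fractional_matching_number_ge_cyclic_indices[OF G _ len, of "{..<length c}"] path
    by (auto simp: is_path_def)
qed

section \<open>Matchings and neighbourhoods\<close>

definition matching :: "'a graph \<Rightarrow> 'a set set \<Rightarrow> bool" where
  "matching G M \<longleftrightarrow> M \<subseteq> edges G \<and> pairwise disjnt M"

lemma card_matching_edges_at:
  assumes "pairwise disjnt M"
  shows "card {e \<in> M. v \<in> e} \<le> 1"
proof -
  have "\<exists>e. {e \<in> M. v \<in> e} \<subseteq> {e}"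
    using assms by (auto simp: pairwise_def disjnt_def) blast
  then show ?thesis using card_mono[of "{_}"] by fastforce
qed

lemma matching_card_le_fractional_matching_number:
  assumes "simple_graph G" "matching G M"
  shows "real (card M) \<le> fractional_matching_number G"
  using half_integral_le_fractional_matching_number[of G M "{}"] assms card_matching_edges_at[of M]
  by (auto simp: matching_def)

lemma maximum_matching_exists:
  assumes "simple_graph G"
  obtains M where "matching G M" "\<And>M'. matching G M' \<Longrightarrow> card M' \<le> card M"
proof -
  have fin: "finite (edges G)" by (rule simple_graph_finite_edges[OF assms])
  then have "\<forall>M'. matching G M' \<longrightarrow> card M' < Suc (card (edges G))"
    by (auto simp: matching_def less_Suc_eq_le card_mono)
  moreover have "matching G {}" by (simp add: matching_def)
  ultimately have "\<exists>M. matching G M \<and> (\<forall>M'. matching G M' \<longrightarrow> card M' \<le> card M)"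
    by (intro ex_has_greatest_nat)
  then show thesis using that by blast
qed

definition neighbours :: "'a graph \<Rightarrow> 'a \<Rightarrow> 'a set" where
  "neighbours G u = {v. {u, v} \<in> edges G}"

text \<open>Every edge at \<open>u\<close> has exactly one other end, so \<open>v\<close> \<mapsto>
  \<open>{u, v}\<close> is a bijection. Counting ends instead of edges allows a degree to be split
  among the edges of a matching.\<close>

lemma card_neighbours:
  assumes "simple_graph G"
  shows "card (neighbours G u) = vertex_degree G u"
proof -
  have "bij_betw (\<lambda>v. {u, v}) (neighbours G u) {e \<in> edges G. u \<in> e}"
    unfolding bij_betw_def
  proof
    show "inj_on (\<lambda>v. {u, v}) (neighbours G u)"
      by (auto simp: inj_on_def doubleton_eq_iff)
    have "e \<in> (\<lambda>v. {u, v}) ` neighbours G u" if "e \<in> edges G" "u \<in> e" for e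
    proof -
      have "card e = 2" using assms that(1) by (auto simp: simple_graph_def)
      then obtain a b where "e = {a, b}" by (auto simp: card_2_iff)
      then have "e = {u, if u = a then b else a}" using \<open>u \<in> e\<close> by auto
      moreover from this have "(if u = a then b else a) \<in> neighbours G u"
        using that(1) by (simp add: neighbours_def)
      ultimately show ?thesis by (rule image_eqI)
    qed
    then show "(\<lambda>v. {u, v}) ` neighbours G u = {e \<in> edges G. u \<in> e}"
      by (auto simp: neighbours_def)
  qed
  then show ?thesis unfolding vertex_degree_def by (rule bij_betw_same_card)
qed

section \<open>Minimum degree and the vertices missed by a maximum matching\<close>

lemma fractional_matching_number_ge_min_degree_or_half:
  assumes G: "simple_graph G"
  shows "real (min_degree G) \<le> fractional_matching_number G
       \<or> real (card (verts G)) / 2 \<le> fractional_matching_number G"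
proof -
  obtain M where M: "matching G M" and max: "\<And>M'. matching G M' \<Longrightarrow> card M' \<le> card M"
    using maximum_matching_exists[OF G] by blast
  have ME: "M \<subseteq> edges G" and disj: "pairwise disjnt M" using M by (auto simp: matching_def)
  have finV: "finite (verts G)" and edge: "\<And>e. e \<in> edges G \<Longrightarrow> e \<subseteq> verts G \<and> card e = 2"
    using G by (auto simp: simple_graph_def)
  have finM: "finite M" using ME simple_graph_finite_edges[OF G] finite_subset by blast
  have M_card: "card e = 2" if "e \<in> M" for e using that ME edge by auto
  then have finMe: "finite e" if "e \<in> M" for e using that by (metis card.infinite zero_neq_numeral)
  have M_sub: "\<Union>M \<subseteq> verts G" using ME edge by blast
  have card_UM: "card (\<Union>M) = 2 * card M"
    using card_Union_disjoint[OF disj] finMe M_card by simp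
  define U where "U = verts G - \<Union>M"
  have card_V: "card (verts G) = 2 * card M + card U"
    using card_Diff_subset[OF finite_subset[OF M_sub finV] M_sub] card_mono[OF finV M_sub] card_UM
    by (simp add: U_def)
  \<comment> \<open>An edge between two unmatched vertices could be added to the maximum matching
    \<open>M\<close>.\<close>
  have U_nbr: "neighbours G u \<subseteq> \<Union>M" if u: "u \<in> U" for u
  proof
    fix v assume v: "v \<in> neighbours G u"
    show "v \<in> \<Union>M"
    proof (rule ccontr)
      assume notin: "v \<notin> \<Union>M"
      have new: "{u, v} \<notin> M" using u by (auto simp: U_def)
      have "matching G (insert {u, v} M)"
        using u v notin ME disj
        by (auto simp: matching_def neighbours_def U_def pairwise_insert disjnt_def)
      from max[OF this] show False using new finM by simp
    qed
  qed
  \<comment> \<open>The edges of \<open>M\<close> partition the matched vertices, which include all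
    neighbours of \<open>u\<close>; so the degree of \<open>u\<close> is the sum of the
    contributions of the edges of \<open>M\<close>.\<close>
  have nbr_sum: "min_degree G \<le> (\<Sum>e\<in>M. card (neighbours G u \<inter> e))" if u: "u \<in> U" for u
  proof -
    have "min_degree G \<le> vertex_degree G u"
      using u finV by (auto simp: min_degree_def U_def)
    also have "\<dots> = card (\<Union>e\<in>M. neighbours G u \<inter> e)"
      using U_nbr[OF u] by (simp add: card_neighbours[OF G, symmetric] Int_Union[symmetric] Int_absorb2)
    also have "\<dots> = (\<Sum>e\<in>M. card (neighbours G u \<inter> e))"
      using disj finMe by (intro card_UN_disjoint finM) (auto simp: pairwise_def disjnt_def)
    finally show ?thesis .
  qed
  have M_le: "real (card M) \<le> fractional_matching_number G"
    by (rule matching_card_le_fractional_matching_number[OF G M])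
  consider "U = {}" | u where "U = {u}" | u v where "u \<in> U" "v \<in> U" "u \<noteq> v" by blast
  then show ?thesis
  proof cases
    case 1
    then show ?thesis using card_V M_le by simp
  next
    case (2 u)
    show ?thesis
    \<comment> \<open>If every edge of \<open>M\<close> contributes at most 1, the degree of
      \<open>u\<close> is at most \<open>card M\<close>. Otherwise some edge contributes 2 and forms
      a triangle with \<open>u\<close>.\<close>
    proof (cases "\<forall>e\<in>M. card (neighbours G u \<inter> e) \<le> 1")
      case True
      then have "(\<Sum>e\<in>M. card (neighbours G u \<inter> e)) \<le> card M"
        using sum_mono[of M "\<lambda>e. card (neighbours G u \<inter> e)" "\<lambda>_. 1"] by simp
      with nbr_sum[of u] 2 M_le show ?thesis by simp
    next
      case False
      then obtain e where e: "e \<in> M" "card (neighbours G u \<inter> e) > 1" by (auto simp: not_le)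
      then have "neighbours G u \<inter> e = e"
        using finMe[OF e(1)] M_card[OF e(1)] by (intro card_seteq) auto
      moreover obtain x y where xy: "e = {x, y}" "x \<noteq> y" using M_card[OF e(1)] by (auto simp: card_2_iff)
      ultimately have ux: "{u, x} \<in> edges G" and uy: "{u, y} \<in> edges G" by (auto simp: neighbours_def)
      have u_notin: "u \<notin> \<Union>M" using 2 by (auto simp: U_def)
      then have ne: "u \<noteq> x" "u \<noteq> y" using e xy by auto
      let ?T = "{{u, x}, {u, y}, {x, y}}"
      have cardT: "card ?T = 3" using ne xy by (simp add: doubleton_eq_iff)
      have "x \<in> e" "y \<in> e" using xy by auto
      then have x_only: "f = e" if "f \<in> M" "x \<in> f" for f
        using pairwiseD[OF disj that(1) e(1)] that(2) by (auto simp: disjnt_iff)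
      have y_only: "f = e" if "f \<in> M" "y \<in> f" for f
        using pairwiseD[OF disj that(1) e(1)] that(2) \<open>y \<in> e\<close> by (auto simp: disjnt_iff)
      \<comment> \<open>The total is (\<open>card M\<close> - 1) + 3/2 = (2 \<open>card M\<close> +
        1)/2, half the number of vertices, as \<open>u\<close> is the only unmatched one.\<close>
      have "real (card (M - {e})) + real (card ?T) / 2 \<le> fractional_matching_number G"
      proof (rule half_integral_le_fractional_matching_number[OF G])
        show "M - {e} \<subseteq> edges G" "?T \<subseteq> edges G" using ME ux uy e xy by auto
        show "(M - {e}) \<inter> ?T = {}" using u_notin xy by auto
        fix w
        show "2 * card {f \<in> M - {e}. w \<in> f} + card {f \<in> ?T. w \<in> f} \<le> 2"
        proof (cases "w \<in> {u, x, y}")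
          case True
          then have "{f \<in> M - {e}. w \<in> f} = {}" using u_notin x_only y_only by auto
          \<comment> \<open>The side of the triangle opposite to the corner \<open>w\<close> avoids
            it, leaving two sides of weight 1/2.\<close>
          moreover have "{f \<in> ?T. w \<in> f} \<subseteq> ?T - {{u, x, y} - {w}}" using True ne xy by auto
          then have "card {f \<in> ?T. w \<in> f} \<le> card (?T - {{u, x, y} - {w}})" by (intro card_mono) auto
          moreover have "{u, x, y} - {w} \<in> ?T" using True ne xy by auto
          then have "card (?T - {{u, x, y} - {w}}) = 2" using cardT by (subst card_Diff_singleton) auto
          ultimately show ?thesis by (metis add_0 card.empty mult_0_right)
        next
          case False
          then have "{f \<in> ?T. w \<in> f} = {}" by auto
          moreover have "card {f \<in> M - {e}. w \<in> f} \<le> 1"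
            using card_matching_edges_at[OF pairwise_subset[OF disj]] by blast
          ultimately show ?thesis by (metis add_0_right card.empty mult_le_mono2 nat_mult_1_right)
        qed
      qed
      moreover have "card M = Suc (card (M - {e}))" by (rule card.remove[OF finM e(1)])
      ultimately show ?thesis using card_V 2 cardT by simp
    qed
  next
    case (3 u v)
    have "card (neighbours G u \<inter> e) + card (neighbours G v \<inter> e) \<le> 2" if e: "e \<in> M" for e
    proof (rule ccontr)
      assume big: "\<not> ?thesis"
      obtain a b where ab: "e = {a, b}" "a \<noteq> b" using M_card[OF e] by (auto simp: card_2_iff)
      \<comment> \<open>The four possible adjacencies between \<open>u\<close>, \<open>v\<close> and
        the ends of \<open>e\<close> split into two crossing pairs. If neither pair is complete,
        each supplies at most one adjacency, so the total is at most 2.\<close>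
      have "\<exists>x y. e = {x, y} \<and> x \<noteq> y \<and> x \<in> neighbours G u \<and> y \<in> neighbours G v"
      proof (rule ccontr)
        assume "\<not> ?thesis"
        then have "\<not> (a \<in> neighbours G u \<and> b \<in> neighbours G v)"
          "\<not> (b \<in> neighbours G u \<and> a \<in> neighbours G v)"
          using ab by blast+
        then show False using big ab
          by (cases "a \<in> neighbours G u"; cases "b \<in> neighbours G u";
              cases "a \<in> neighbours G v"; cases "b \<in> neighbours G v") (auto simp: card_insert_if)
      qed
      then obtain x y where xy: "e = {x, y}" "x \<noteq> y" "x \<in> neighbours G u" "y \<in> neighbours G v"
        by blast
      have notin: "u \<notin> \<Union>M" "v \<notin> \<Union>M" using 3 by (auto simp: U_def)
      then have ne: "u \<noteq> x" "u \<noteq> y" "v \<noteq> x" "v \<noteq> y" using e xy by auto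
      have xy_only: "x \<notin> f" "y \<notin> f" if "f \<in> M - {e}" for f
      proof -
        have "disjnt f e" using pairwiseD[OF disj _ e] that by blast
        then show "x \<notin> f" "y \<notin> f" using xy(1) by (auto simp: disjnt_iff)
      qed
      \<comment> \<open>Switching along the augmenting path u-x-y-v trades its middle edge
        \<open>e\<close> for the two outer ones.\<close>
      let ?M = "insert {u, x} (insert {v, y} (M - {e}))"
      have "matching G ?M"
        unfolding matching_def
      proof
        have "{u, x} \<in> edges G" "{v, y} \<in> edges G" using xy(3,4) by (auto simp: neighbours_def)
        then show "?M \<subseteq> edges G" using ME by blast
        have "disjnt {u, x} {v, y}" using xy(2) ne 3(3) by (simp add: disjnt_def)
        moreover have "disjnt {u, x} f" "disjnt {v, y} f" if "f \<in> M - {e}" for f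
          using xy_only[OF that] notin that by (auto simp: disjnt_def)
        moreover have "pairwise disjnt (M - {e})" using disj by (rule pairwise_subset) blast
        ultimately show "pairwise disjnt ?M"
          unfolding pairwise_insert by (blast intro: disjnt_sym)
      qed
      moreover have "card ?M = Suc (card M)"
      proof -
        have "{u, x} \<noteq> {v, y}" using ne 3 xy by (auto simp: doubleton_eq_iff)
        moreover have "{u, x} \<notin> M" "{v, y} \<notin> M" using notin by auto
        moreover have "card M = Suc (card (M - {e}))" by (rule card.remove[OF finM e])
        ultimately show ?thesis using finM by simp
      qed
      ultimately show False using max[of ?M] by simp
    qed
    then have "(\<Sum>e\<in>M. card (neighbours G u \<inter> e)) + (\<Sum>e\<in>M. card (neighbours G v \<inter> e)) \<le> 2 * card M"
      using sum_mono[of M "\<lambda>e. card (neighbours G u \<inter> e) + card (neighbours G v \<inter> e)" "\<lambda>_. 2"]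
      by (simp add: sum.distrib)
    then have "min_degree G \<le> card M" using nbr_sum[OF 3(1)] nbr_sum[OF 3(2)] by linarith
    then show ?thesis using M_le by simp
  qed
qed

theorem theorem2p2:
  fixes G :: "'a graph" and n \<delta> s :: nat and k :: real
  assumes "simple_graph G" and "connected_graph G"
    and "n = card (verts G)" and "\<delta> = min_degree G"
    and "0 < k" and "k < real n" and "s \<ge> 1"
  shows "((\<exists>L. subgraph L G \<and> max_degree L \<le> 2 \<and> card (edges L) \<ge> 2 * s)
            \<longrightarrow> fractional_matching_number G \<ge> real s)
       \<and> ((\<exists>c. is_cycle G c \<and> length c \<ge> 2 * \<delta>) \<or> (\<exists>p. is_path G p \<and> length p - 1 \<ge> 2 * \<delta>)
            \<longrightarrow> fractional_matching_number G \<ge> real \<delta>)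
       \<and> (real \<delta> > (real n - k) / 2 \<longrightarrow> fractional_matching_number G > (real n - k) / 2)"
proof (intro conjI impI)
  assume "\<exists>L. subgraph L G \<and> max_degree L \<le> 2 \<and> card (edges L) \<ge> 2 * s"
  then obtain L where L: "subgraph L G" "max_degree L \<le> 2" "card (edges L) \<ge> 2 * s" by blast
  show "fractional_matching_number G \<ge> real s"
    using fractional_matching_number_ge_subgraph[OF assms(1) L(1,2)] L(3) by linarith
next
  assume "(\<exists>c. is_cycle G c \<and> length c \<ge> 2 * \<delta>) \<or> (\<exists>p. is_path G p \<and> length p - 1 \<ge> 2 * \<delta>)"
  then show "fractional_matching_number G \<ge> real \<delta>"
  proof (elim disjE exE conjE)
    fix c assume c: "is_cycle G c" "length c \<ge> 2 * \<delta>"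
    show ?thesis using fractional_matching_number_ge_cycle[OF assms(1) c(1)] c(2) by linarith
  next
    fix p assume p: "is_path G p" "length p - 1 \<ge> 2 * \<delta>"
    show ?thesis
    \<comment> \<open>For \<delta> = 0 the path may have fewer than three vertices, and the empty
      matching gives the bound. For \<delta> \<ge> 1 the path has at least two edges, hence at least
      three vertices.\<close>
    proof (cases "\<delta> = 0")
      case True
      then show ?thesis
        using matching_card_le_fractional_matching_number[OF assms(1), of "{}"]
        by (simp add: matching_def)
    next
      case False
      then have "length p \<ge> 3" using p(2) by linarith
      from fractional_matching_number_ge_path[OF assms(1) p(1) this] p(2) show ?thesis by linarith
    qed
  qed
next
  assume "real \<delta> > (real n - k) / 2"
  \<comment> \<open>Positivity of \<open>k\<close> makes the bound n/2 strict; the bound \<delta> is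
    strict by assumption, so either alternative suffices.\<close>
  moreover have "real n / 2 > (real n - k) / 2" using assms(5) by simp
  ultimately show "fractional_matching_number G > (real n - k) / 2"
    using fractional_matching_number_ge_min_degree_or_half[OF assms(1)] assms(3,4) by auto
qed

end
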